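(* Let $\Lambda_t:=\{\lambda_t>0:\ \mathcal R(\lambda_t)-\mathcal C(\lambda_t,\lambda_s)=0\ \text{for all }\lambda_s>0\}$ and, for $\lambda_t>0$, $\Lambda_s(\lambda_t):=\{\lambda_s>0:\ \mathcal R(\lambda_t)-\mathcal C(\lambda_t,\lambda_s)=0\}$. For any $\lambda_t>0$ with $\lambda_t\notin\Lambda_t$, the cardinality of $\Lambda_s(\lambda_t)$ is at most the number of sign changes in the sequence $(d_1,\dots,d_{\tilde m})$ after deleting its zero entries (where $d_j=d_j(\lambda_t)$).
   Context: Let $p,n_t,n_s$ be positive integers, $\gamma_t=p/n_t$, $\gamma_s=p/n_s$, $\overline{\mathrm{tr}}(A)=\mathrm{tr}(A)/p$. Let $\Sigma_t,\Sigma_s\in\mathbb R^{p\times p}$ be positive definite and simultaneously diagonalizable: $\Sigma_t=U^\top\mathrm{diag}(\sigma_1,\dots,\sigma_p)U$, $\Sigma_s=U^\top\mathrm{diag}(\tilde\sigma_1,\dots,\tilde\sigma_p)U$ with $U$ orthogonal. Let $\beta\in\mathbb R^p$ and $\sigma^2\ge0$. For $\lambda_t,\lambda_s>0$ let $\kappa_t=\kappa_t(\lambda_t)>0$ and $\kappa_s=\kappa_s(\lambda_s)>0$ be the unique positive solutions of $\kappa_t=\lambda_t+\gamma_t\kappa_t\overline{\mathrm{tr}}(\Sigma_t(\Sigma_t+\kappa_tI_p)^{-1})$ and $\kappa_s=\lambda_s+\gamma_s\kappa_s\overline{\mathrm{tr}}(\Sigma_s(\Sigma_s+\kappa_sI_p)^{-1})$.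 Set $G_t=(\Sigma_t+\kappa_tI_p)^{-1}$, $G_s=(\Sigma_s+\kappa_sI_p)^{-1}$, $q_{i,j}=\beta^\top G_t^iG_s^j\Sigma_t\beta$, $t_{i,j}=\gamma_t\overline{\mathrm{tr}}(\Sigma_t^2G_t^iG_s^j)$, $b_t=(1-t_{2,0})^{-1}$. The limiting teacher risk and limiting teacher-student residual correlation are $$\mathcal R(\lambda_t)=\sigma^2+\kappa_t^2b_tq_{2,0}+\sigma^2b_tt_{2,0},\qquad \mathcal C(\lambda_t,\lambda_s)=\mathcal R(\lambda_t)-\kappa_s\big(-\kappa_tq_{1,1}+\kappa_t^2q_{2,1}+\kappa_t^2b_tt_{2,1}q_{2,0}+\sigma^2b_tt_{2,1}\big).$$ Let $v_i=((U\beta)_i)^2$ for $i=1,\dots,p$. Let $\tilde\sigma_{(1)}<\dots<\tilde\sigma_{(\tilde m)}$ be the distinct eigenvalues of $\Sigma_s$. Define $$c_i=\frac{\kappa_t\sigma_i^2}{(\sigma_i+\kappa_t)^2}\Big(\frac{\kappa_t^2b_tq_{2,0}+\sigma^2b_t}{\kappa_tn_t}-v_i\Big)\ (1\le i\le p),\qquad d_j=\sum_{k:\tilde\sigma_k=\tilde\sigma_{(j)}}c_k\ (1\le j\le\tilde m).$$ A sign change in a sequence of nonzero reals is a pair of consecutive entries of opposite sign. *)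

theory Defs
  imports "HOL-Analysis.Analysis"
begin

text \<open>The dimension is \<open>p = CARD('n)\<close>.\<close>

definition diag_matrix :: "real ^ 'n \<Rightarrow> real ^ 'n ^ 'n" where
  "diag_matrix s = (\<chi> i j. if i = j then s $ i else 0)"

definition pos_def_matrix :: "real ^ 'n ^ 'n \<Rightarrow> bool" where
  "pos_def_matrix A \<longleftrightarrow> transpose A = A \<and> (\<forall>x. x \<noteq> 0 \<longrightarrow> 0 < x \<bullet> (A *v x))"

definition eigenvalues :: "real ^ 'n ^ 'n \<Rightarrow> real set" where
  "eigenvalues A = {\<mu>. \<exists>x. x \<noteq> 0 \<and> A *v x = \<mu> *\<^sub>R x}"

text \<open>The library operations \<open>*\<close> and \<open>^\<close> on \<open>real ^ 'n ^ 'n\<close> are entrywise, so powers for the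
  matrix product are defined here.\<close>

primrec mat_power :: "real ^ 'n ^ 'n \<Rightarrow> nat \<Rightarrow> real ^ 'n ^ 'n" where
  "mat_power A 0 = mat 1"
| "mat_power A (Suc k) = A ** mat_power A k"

definition norm_trace :: "real ^ 'n ^ 'n \<Rightarrow> real" where
  "norm_trace A = trace A / real CARD('n)"

definition gam :: "'n itself \<Rightarrow> nat \<Rightarrow> real" where
  "gam _ n = real CARD('n) / real n"

definition kappa :: "nat \<Rightarrow> real ^ 'n ^ 'n \<Rightarrow> real \<Rightarrow> real" where
  "kappa n S l = (THE k. 0 < k \<and>
     k = l + gam TYPE('n) n * k * norm_trace (S ** matrix_inv (S + k *\<^sub>R mat 1)))"

definition G_mat :: "nat \<Rightarrow> real ^ 'n ^ 'n \<Rightarrow> real \<Rightarrow> real ^ 'n ^ 'n" where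
  "G_mat n S l = matrix_inv (S + kappa n S l *\<^sub>R mat 1)"

definition q_coef ::
  "real ^ 'n ^ 'n \<Rightarrow> real ^ 'n \<Rightarrow> real ^ 'n ^ 'n \<Rightarrow> real ^ 'n ^ 'n \<Rightarrow> nat \<Rightarrow> nat \<Rightarrow> real" where
  "q_coef St \<beta> Gt Gs i j = \<beta> \<bullet> ((mat_power Gt i ** mat_power Gs j ** St) *v \<beta>)"

definition t_coef ::
  "nat \<Rightarrow> real ^ 'n ^ 'n \<Rightarrow> real ^ 'n ^ 'n \<Rightarrow> real ^ 'n ^ 'n \<Rightarrow> nat \<Rightarrow> nat \<Rightarrow> real" where
  "t_coef nt St Gt Gs i j =
     gam TYPE('n) nt * norm_trace (mat_power St 2 ** mat_power Gt i ** mat_power Gs j)"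

text \<open>The coefficients \<open>q\<^sub>2\<^sub>,\<^sub>0\<close> and \<open>t\<^sub>2\<^sub>,\<^sub>0\<close> do not involve the student matrix, whose exponent is
  \<open>0\<close>; \<open>mat 1\<close> is passed in its place.\<close>

definition q20 :: "nat \<Rightarrow> real ^ 'n ^ 'n \<Rightarrow> real ^ 'n \<Rightarrow> real \<Rightarrow> real" where
  "q20 nt St \<beta> lt = q_coef St \<beta> (G_mat nt St lt) (mat 1) 2 0"

definition t20 :: "nat \<Rightarrow> real ^ 'n ^ 'n \<Rightarrow> real \<Rightarrow> real" where
  "t20 nt St lt = t_coef nt St (G_mat nt St lt) (mat 1) 2 0"

definition b_coef :: "nat \<Rightarrow> real ^ 'n ^ 'n \<Rightarrow> real \<Rightarrow> real" where
  "b_coef nt St lt = inverse (1 - t20 nt St lt)"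

text \<open>In the following, \<open>s2\<close> is the noise variance \<open>\<sigma>\<^sup>2\<close>.\<close>

definition teacher_risk ::
  "nat \<Rightarrow> real ^ 'n ^ 'n \<Rightarrow> real ^ 'n \<Rightarrow> real \<Rightarrow> real \<Rightarrow> real" where
  "teacher_risk nt St \<beta> s2 lt =
     s2 + (kappa nt St lt)\<^sup>2 * b_coef nt St lt * q20 nt St \<beta> lt
        + s2 * b_coef nt St lt * t20 nt St lt"

definition residual_corr ::
  "nat \<Rightarrow> nat \<Rightarrow> real ^ 'n ^ 'n \<Rightarrow> real ^ 'n ^ 'n \<Rightarrow> real ^ 'n \<Rightarrow> real \<Rightarrow> real \<Rightarrow> real \<Rightarrow> real" where
  "residual_corr nt ns St Ss \<beta> s2 lt ls =
    (let kt = kappa nt St lt; ks = kappa ns Ss ls;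
         Gt = G_mat nt St lt; Gs = G_mat ns Ss ls;
         q = q_coef St \<beta> Gt Gs; t = t_coef nt St Gt Gs; b = b_coef nt St lt
     in teacher_risk nt St \<beta> s2 lt
        - ks * (- kt * q 1 1 + kt\<^sup>2 * q 2 1 + kt\<^sup>2 * b * t 2 1 * q 2 0 + s2 * b * t 2 1))"

definition Lambda_t ::
  "nat \<Rightarrow> nat \<Rightarrow> real ^ 'n ^ 'n \<Rightarrow> real ^ 'n ^ 'n \<Rightarrow> real ^ 'n \<Rightarrow> real \<Rightarrow> real set" where
  "Lambda_t nt ns St Ss \<beta> s2 = {lt. 0 < lt \<and>
     (\<forall>ls>0. teacher_risk nt St \<beta> s2 lt - residual_corr nt ns St Ss \<beta> s2 lt ls = 0)}"

definition Lambda_s ::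
  "nat \<Rightarrow> nat \<Rightarrow> real ^ 'n ^ 'n \<Rightarrow> real ^ 'n ^ 'n \<Rightarrow> real ^ 'n \<Rightarrow> real \<Rightarrow> real \<Rightarrow> real set" where
  "Lambda_s nt ns St Ss \<beta> s2 lt = {ls. 0 < ls \<and>
     teacher_risk nt St \<beta> s2 lt - residual_corr nt ns St Ss \<beta> s2 lt ls = 0}"

text \<open>Below, \<open>U\<close> is the common diagonalizing matrix and \<open>st\<close>, \<open>ss\<close> are the diagonals
  \<open>(\<sigma>\<^sub>i)\<close> and \<open>(\<sigma>~\<^sub>i)\<close> of \<open>St\<close> and \<open>Ss\<close> in that basis.\<close>

definition c_coef ::
  "nat \<Rightarrow> real ^ 'n ^ 'n \<Rightarrow> real ^ 'n ^ 'n \<Rightarrow> real ^ 'n \<Rightarrow> real ^ 'n \<Rightarrow> real \<Rightarrow> real \<Rightarrow> 'n \<Rightarrow> real" where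
  "c_coef nt St U st \<beta> s2 lt i =
    (let kt = kappa nt St lt; b = b_coef nt St lt
     in kt * (st $ i)\<^sup>2 / (st $ i + kt)\<^sup>2
        * ((kt\<^sup>2 * b * q20 nt St \<beta> lt + s2 * b) / (kt * real nt) - ((U *v \<beta>) $ i)\<^sup>2))"

definition d_seq ::
  "nat \<Rightarrow> real ^ 'n ^ 'n \<Rightarrow> real ^ 'n ^ 'n \<Rightarrow> real ^ 'n ^ 'n \<Rightarrow> real ^ 'n \<Rightarrow> real ^ 'n
     \<Rightarrow> real ^ 'n \<Rightarrow> real \<Rightarrow> real \<Rightarrow> real list" where
  "d_seq nt St Ss U st ss \<beta> s2 lt =
     map (\<lambda>\<mu>. \<Sum>k | ss $ k = \<mu>. c_coef nt St U st \<beta> s2 lt k)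
       (sorted_list_of_set (eigenvalues Ss))"

definition sign_changes :: "real list \<Rightarrow> nat" where
  "sign_changes ys = card {i. Suc i < length ys \<and> ys ! i * ys ! Suc i < 0}"

end

theory Submission
  imports Defs
begin

text \<open>
  In the common eigenbasis all matrices are diagonal, and the gap between teacher risk and residual
  correlation collapses to a sum of partial fractions in the effective student regularization
  \<open>x = \<kappa>\<^sub>s\<close>, namely \<open>x * (\<Sum>i. c\<^sub>i / (\<sigma>~\<^sub>i + x))\<close> (\<open>risk_minus_corr_eq\<close>). Grouping equal
  student eigenvalues turns the coefficients into the \<open>d\<^sub>j\<close>. The map from \<open>\<lambda>\<^sub>s > 0\<close> to \<open>\<kappa>\<^sub>s > 0\<close> is
  injective because its defining equation can be solved for \<open>\<lambda>\<^sub>s\<close> (\<open>inj_on_kappa_spectral\<close>), so it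
  suffices to count the positive zeros of \<open>x \<mapsto> \<Sum>j. d\<^sub>j / (\<mu>\<^sub>j + x)\<close>. That \<open>\<lambda>\<^sub>t\<close> lies outside the
  exceptional set \<open>\<Lambda>\<^sub>t\<close> says exactly that some \<open>d\<^sub>j\<close> is nonzero.

  The count is a Descartes rule for partial fractions (\<open>card_zeros_partial_fractions_le\<close>).
  If the sign changes between \<open>\<mu>\<^sub>j\<close> and \<open>\<mu>\<^sub>j\<^sub>+\<^sub>1\<close>, choose \<open>c\<close> strictly between them. Multiplying a
  sum of \<open>r\<close>-th powers of the fractions by \<open>(x + c) ^ r\<close> keeps its positive zeros, and differentiating
  the product multiplies the coefficient \<open>d\<^sub>i\<close> by \<open>\<mu>\<^sub>i - c\<close>, up to a common positive factor, and
  raises the exponent \<open>r\<close> by one. The factors \<open>\<mu>\<^sub>i - c\<close> change sign exactly once, at the chosen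
  place, so one sign change disappears, while Rolle's theorem loses at most one zero.
\<close>

section \<open>Sign changes bound the zeros of sums of partial fractions\<close>

text \<open>
  Rolle's theorem puts a zero of the derivative strictly between any two consecutive zeros of the
  function. Finiteness is not known beforehand, so the bound is first shown for finite sets of
  zeros, which are built up by adding new maxima; the bounded size of all finite subsets then gives
  finiteness.
\<close>

lemma card_zeros_le_Suc_card_zeros_deriv:
  fixes f f' :: "real \<Rightarrow> real"
  assumes deriv: "\<And>x. 0 < x \<Longrightarrow> (f has_real_derivative f' x) (at x)"
    and fin: "finite {x. 0 < x \<and> f' x = 0}"
  shows "finite {x. 0 < x \<and> f x = 0}"
    and "card {x. 0 < x \<and> f x = 0} \<le> Suc (card {x. 0 < x \<and> f' x = 0})"
proof -
  let ?D = "\<lambda>b. {y. 0 < y \<and> f' y = 0 \<and> y < b}"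
  have fin_D: "finite (?D b)" for b
    by (rule finite_subset[OF _ fin]) auto
  have *: "Z \<subseteq> {x. 0 < x \<and> f x = 0} \<Longrightarrow> Z \<noteq> {} \<Longrightarrow> card Z \<le> Suc (card (?D (Max Z)))"
    if "finite Z" for Z
    using that
  proof (induction Z rule: finite_linorder_max_induct)
    case empty
    then show ?case by simp
  next
    case (insert b A)
    show ?case
    proof (cases "A = {}")
      case True
      then show ?thesis by simp
    next
      case False
      define a where "a = Max A"
      have aA: "a \<in> A"
        unfolding a_def using insert.hyps False by simp
      have a: "0 < a" "f a = 0" "a < b" "f b = 0"
        using aA insert by auto
      have "\<exists>z>a. z < b \<and> (*) (f' z) = (\<lambda>v. 0)"
      proof (rule Rolle_deriv)
        show "a < b" "f a = f b" using a by auto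
        show "continuous_on {a..b} f"
          using a by (intro continuous_at_imp_continuous_on ballI) (auto intro!: DERIV_isCont deriv)
        show "(f has_derivative (*) (f' x)) (at x)" if "a < x" "x < b" for x
          using deriv[of x] that a by (simp add: has_field_derivative_def)
      qed
      then obtain z where z: "a < z" "z < b" and "(*) (f' z) = (\<lambda>v. 0)"
        by blast
      have "f' z = 0"
        using fun_cong[OF \<open>(*) (f' z) = (\<lambda>v. 0)\<close>, of 1] by simp
      have "card (?D a) < card (?D b)"
      proof (rule psubset_card_mono[OF fin_D])
        have "z \<in> ?D b" "z \<notin> ?D a"
          using z a(1) \<open>f' z = 0\<close> by simp_all
        moreover have "?D a \<subseteq> ?D b"
          using a(3) by force
        ultimately show "?D a \<subset> ?D b"
          by blast
      qed
      moreover have "Max (insert b A) = b"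
        using insert.hyps by (intro Max_eqI) auto
      moreover have "card (insert b A) = Suc (card A)"
        using insert.hyps by auto
      moreover have "card A \<le> Suc (card (?D a))"
        using insert False by (simp add: a_def)
      ultimately show ?thesis by simp
    qed
  qed
  have bound: "card Z \<le> Suc (card {x. 0 < x \<and> f' x = 0})"
    if "Z \<subseteq> {x. 0 < x \<and> f x = 0}" "finite Z" for Z
  proof (cases "Z = {}")
    case False
    have "card (?D (Max Z)) \<le> card {x. 0 < x \<and> f' x = 0}"
      by (rule card_mono[OF fin]) auto
    then show ?thesis
      using *[OF that(2,1) False] by simp
  qed simp
  show "finite {x. 0 < x \<and> f x = 0}"
    and "card {x. 0 < x \<and> f x = 0} \<le> Suc (card {x. 0 < x \<and> f' x = 0})"
    using finite_if_finite_subsets_card_bdd[OF bound] by blast+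
qed

text \<open>
  Induction on the number of sign changes. The exponent has to vary along with the coefficients,
  since each differentiation raises it. Without sign changes all summands have the same sign, and
  the sum has no zero.
\<close>

lemma card_zeros_partial_fractions_le:
  fixes \<mu> d :: "nat \<Rightarrow> real"
  assumes "0 < m"
    and "\<And>i. i < m \<Longrightarrow> 0 < \<mu> i"
    and "\<And>i j. i < j \<Longrightarrow> j < m \<Longrightarrow> \<mu> i < \<mu> j"
    and "\<And>i. i < m \<Longrightarrow> d i \<noteq> 0"
  defines "Zeros \<equiv> \<lambda>k d. {x. 0 < x \<and> (\<Sum>i<m. d i / (\<mu> i + x) ^ Suc k) = 0}"
    and "Changes \<equiv> \<lambda>d. {i. Suc i < m \<and> d i * d (Suc i) < 0}"
  shows "finite (Zeros k d) \<and> card (Zeros k d) \<le> card (Changes d)"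
  using assms(4)
proof (induction "card (Changes d)" arbitrary: d k)
  case 0
  have fin: "finite (Changes d)" for d
    by (rule finite_subset[of _ "{..<m}"]) (auto simp: Changes_def)
  note d_nz = "0.prems"
  have none: "Changes d = {}"
    using 0(1) fin[of d] by simp
  have step: "0 < d i * d (Suc i)" if "Suc i < m" for i
  proof -
    have "\<not> d i * d (Suc i) < 0"
      using none that unfolding Changes_def by blast
    moreover have "d i * d (Suc i) \<noteq> 0"
      using d_nz[of i] d_nz[of "Suc i"] that by simp
    ultimately show ?thesis by linarith
  qed
  have same_sign: "i < m \<Longrightarrow> 0 < d 0 * d i" for i
  proof (induction i)
    case 0
    then show ?case using d_nz[of 0] by (simp add: zero_less_mult_iff linorder_neq_iff disj_commute)
  next
    case (Suc i)
    then show ?case using step[of i] by (auto simp: zero_less_mult_iff)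
  qed
  have "(\<Sum>i<m. d i / (\<mu> i + x) ^ Suc k) \<noteq> 0" if "0 < x" for x
  proof -
    have "0 < (\<Sum>i<m. d 0 * d i / (\<mu> i + x) ^ Suc k)"
      using same_sign assms(1,2) that
      by (intro sum_pos divide_pos_pos zero_less_power add_pos_pos) auto
    also have "\<dots> = d 0 * (\<Sum>i<m. d i / (\<mu> i + x) ^ Suc k)"
      by (simp add: sum_distrib_left)
    finally show ?thesis by auto
  qed
  then have "Zeros k d = {}"
    by (auto simp: Zeros_def)
  then show ?case by simp
next
  case (Suc n)
  have fin: "finite (Changes d)" for d
    by (rule finite_subset[of _ "{..<m}"]) (auto simp: Changes_def)
  have "Changes d \<noteq> {}"
    using Suc(2) by auto
  then obtain i0 where i0: "Suc i0 < m" "d i0 * d (Suc i0) < 0"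
    by (auto simp: Changes_def)
  define c where "c = (\<mu> i0 + \<mu> (Suc i0)) / 2"
  have c: "\<mu> i0 < c" "c < \<mu> (Suc i0)" "0 < c"
    using assms(3)[of i0 "Suc i0"] assms(2)[of i0] i0 by (auto simp: c_def)
  have below: "\<mu> i < c" if "i \<le> i0" for i
    using that c assms(3)[of i i0] i0 by (cases "i = i0") auto
  have above: "c < \<mu> i" if "i0 < i" "i < m" for i
    using that c assms(3)[of "Suc i0" i] i0 by (cases "i = Suc i0") auto
  define e where "e i = d i * (\<mu> i - c)" for i
  have e_nz: "e i \<noteq> 0" if "i < m" for i
    using Suc.prems[OF that] below[of i] above[of i] that
    by (cases "i \<le> i0") (auto simp: e_def)
  have "Changes e = Changes d - {i0}"
  proof -
    have flip: "e i * e (Suc i) < 0 \<longleftrightarrow> i \<noteq> i0 \<and> d i * d (Suc i) < 0" if "Suc i < m" for i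
    proof -
      have eq: "e i * e (Suc i) = (d i * d (Suc i)) * ((\<mu> i - c) * (\<mu> (Suc i) - c))"
        by (simp add: e_def)
      show ?thesis
      proof (cases "i = i0")
        case True
        then have "(\<mu> i - c) * (\<mu> (Suc i) - c) < 0"
          using c by (simp add: mult_less_0_iff)
        then have "0 < e i * e (Suc i)"
          unfolding eq using True i0 by (intro mult_neg_neg) auto
        then show ?thesis
          using True by simp
      next
        case False
        then have "0 < (\<mu> i - c) * (\<mu> (Suc i) - c)"
          using below[of i] below[of "Suc i"] above[of i] above[of "Suc i"] that
          by (cases "i < i0") (auto simp: zero_less_mult_iff)
        then show ?thesis
          unfolding eq by (subst mult_less_0_iff) (use False in auto)
      qed
    qed
    show ?thesis
      using flip by (auto simp: Changes_def)
  qed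
  then have card_e: "n = card (Changes e)"
    using Suc(2) i0 fin[of d] by (simp add: Changes_def)
  have IH: "finite (Zeros (Suc k) e)" "card (Zeros (Suc k) e) \<le> n"
    using Suc.hyps(1)[OF card_e, of "Suc k"] e_nz card_e by auto
  \<comment> \<open>The factor \<open>x + c\<close> makes each summand a power of a Moebius function of \<open>x\<close> whose derivative
    \<open>(\<mu> i - c) / (\<mu> i + x)\<^sup>2\<close> changes sign in \<open>i\<close> exactly where \<open>\<mu> i\<close> passes \<open>c\<close>.\<close>
  define F where "F x = (\<Sum>i<m. d i * ((x + c) / (\<mu> i + x)) ^ Suc k)" for x
  define F' where
    "F' x = real (Suc k) * (x + c) ^ k * (\<Sum>i<m. e i / (\<mu> i + x) ^ Suc (Suc k))" for x
  have zeros_F: "Zeros k d = {x. 0 < x \<and> F x = 0}"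
  proof -
    have "F x = (x + c) ^ Suc k * (\<Sum>i<m. d i / (\<mu> i + x) ^ Suc k)" for x
      unfolding F_def sum_distrib_left by (rule sum.cong) (simp_all add: power_divide)
    then show ?thesis
      using c by (auto simp: Zeros_def)
  qed
  have zeros_F': "Zeros (Suc k) e = {x. 0 < x \<and> F' x = 0}"
    using c by (auto simp: Zeros_def F'_def simp del: of_nat_Suc)
  have "(F has_real_derivative F' x) (at x)" if "0 < x" for x
  proof -
    have summand: "((\<lambda>x. d i * ((x + c) / (\<mu> i + x)) ^ Suc k) has_real_derivative
        real (Suc k) * (x + c) ^ k * (e i / (\<mu> i + x) ^ Suc (Suc k))) (at x)"
      if "i < m" for i
    proof -
      have pos: "0 < \<mu> i + x"
        using assms(2)[OF that] \<open>0 < x\<close> by simp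
      have "((\<lambda>x. (x + c) / (\<mu> i + x)) has_real_derivative (\<mu> i - c) / (\<mu> i + x)\<^sup>2) (at x)"
        using pos by (auto intro!: derivative_eq_intros simp: power2_eq_square)
      from DERIV_cmult[OF DERIV_power[OF this, of "Suc k"], of "d i"] show ?thesis
        by (rule DERIV_cong) (simp add: e_def power_divide power2_eq_square mult_ac)
    qed
    show ?thesis
      unfolding F_def F'_def sum_distrib_left
      by (rule DERIV_sum) (use summand in auto)
  qed
  note Rolle = card_zeros_le_Suc_card_zeros_deriv[of F F', OF this IH(1)[unfolded zeros_F']]
  have "card (Zeros k d) \<le> Suc n"
    using Rolle(2) IH(2) unfolding zeros_F zeros_F' by linarith
  then show ?case
    using Rolle(1) Suc.hyps(2) by (simp add: zeros_F)
qed

section \<open>Functional calculus in the common eigenbasis\<close>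

text \<open>
  This is the functional calculus for the orthonormal eigenbasis formed by the rows of \<open>U\<close>: sums,
  products, inverses, traces and quadratic forms become pointwise operations on \<open>f\<close>.
\<close>

definition spectral :: "real ^ 'n ^ 'n \<Rightarrow> ('n \<Rightarrow> real) \<Rightarrow> real ^ 'n ^ 'n" where
  "spectral U f = transpose U ** diag_matrix (\<chi> i. f i) ** U"

lemma diag_matrix_mult:
  "diag_matrix (\<chi> i. f i) ** diag_matrix (\<chi> i. g i) = diag_matrix (\<chi> i. f i * g i)"
  by (simp add: diag_matrix_def matrix_matrix_mult_def vec_eq_iff if_distrib[of "\<lambda>x. _ * x"]
      if_distribR cong: if_cong)

lemma spectral_mult:
  assumes "orthogonal_matrix U"
  shows "spectral U f ** spectral U g = spectral U (\<lambda>i. f i * g i)"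
proof -
  have "spectral U f ** spectral U g = transpose U ** diag_matrix (\<chi> i. f i) **
      (U ** transpose U) ** diag_matrix (\<chi> i. g i) ** U"
    by (simp add: spectral_def matrix_mul_assoc)
  also have "\<dots> = spectral U (\<lambda>i. f i * g i)"
    using assms by (simp add: orthogonal_matrix_def spectral_def matrix_mul_assoc[symmetric])
      (simp add: matrix_mul_assoc diag_matrix_mult)
  finally show ?thesis .
qed

lemma diag_matrix_apply: "diag_matrix (\<chi> i. f i) *v x = (\<chi> i. f i * x $ i)"
  by (simp add: diag_matrix_def matrix_vector_mult_def vec_eq_iff if_distribR
      if_distrib[of "\<lambda>x. x * _"] cong: if_cong)

lemma orthogonal_matrix_vector_eq_iff:
  fixes x y :: "real ^ 'n"
  assumes "orthogonal_matrix U"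
  shows "U *v x = U *v y \<longleftrightarrow> x = y"
proof
  assume "U *v x = U *v y"
  then have "(transpose U ** U) *v x = (transpose U ** U) *v y"
    by (simp only: matrix_vector_mul_assoc[symmetric])
  then show "x = y"
    using assms by (simp add: orthogonal_matrix_def)
qed simp

lemma orthogonal_matrix_vector_surj:
  fixes y :: "real ^ 'n"
  assumes "orthogonal_matrix U"
  obtains x where "U *v x = y"
proof
  have "U *v (transpose U *v y) = (U ** transpose U) *v y"
    by (simp only: matrix_vector_mul_assoc)
  then show "U *v (transpose U *v y) = y"
    using assms by (simp add: orthogonal_matrix_def)
qed

lemma spectral_apply:
  assumes "orthogonal_matrix U"
  shows "U *v (spectral U f *v x) = (\<chi> i. f i * (U *v x) $ i)"
proof -
  have "U *v (spectral U f *v x) = (U ** transpose U) *v (diag_matrix (\<chi> i. f i) *v (U *v x))"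
    by (simp add: spectral_def matrix_vector_mul_assoc matrix_mul_assoc)
  then show ?thesis
    using assms by (simp add: orthogonal_matrix_def diag_matrix_apply)
qed

lemma spectral_one:
  assumes "orthogonal_matrix U"
  shows "spectral U (\<lambda>i. 1) = mat 1"
proof -
  have "spectral U (\<lambda>i. 1) *v x = mat 1 *v x" for x
    by (subst orthogonal_matrix_vector_eq_iff[OF assms, symmetric])
      (simp add: spectral_apply[OF assms] vec_eq_iff)
  then show ?thesis
    unfolding matrix_eq by blast
qed

lemma spectral_plus_scaleR_one:
  assumes "orthogonal_matrix U"
  shows "spectral U f + k *\<^sub>R mat 1 = spectral U (\<lambda>i. f i + k)"
proof -
  have "(spectral U f + k *\<^sub>R mat 1) *v x = spectral U (\<lambda>i. f i + k) *v x" for x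
    by (subst orthogonal_matrix_vector_eq_iff[OF assms, symmetric])
      (simp add: spectral_apply[OF assms] matrix_vector_mult_add_rdistrib
        matrix_vector_right_distrib scaleR_matrix_vector_assoc[symmetric]
        matrix_vector_mult_scaleR vec_eq_iff algebra_simps)
  then show ?thesis
    unfolding matrix_eq by blast
qed

lemma spectral_inverse:
  assumes "orthogonal_matrix U" and "\<And>i. f i \<noteq> 0"
  shows "matrix_inv (spectral U f) = spectral U (\<lambda>i. inverse (f i))"
proof -
  let ?A = "spectral U f" and ?B = "spectral U (\<lambda>i. inverse (f i))"
  have AB: "?A ** ?B = mat 1 \<and> ?B ** ?A = mat 1"
    using assms by (simp add: spectral_mult spectral_one)
  then have "matrix_inv ?A ** ?A = mat 1"
    unfolding matrix_inv_def by (rule someI2) simp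
  then have "?B = matrix_inv ?A ** (?A ** ?B)"
    by (simp only: matrix_mul_assoc matrix_mul_lid)
  then show ?thesis
    using AB by (simp only: matrix_mul_rid)
qed

lemma spectral_power:
  assumes "orthogonal_matrix U"
  shows "mat_power (spectral U f) k = spectral U (\<lambda>i. f i ^ k)"
  by (induction k) (simp_all add: spectral_mult spectral_one assms)

lemma trace_spectral:
  assumes "orthogonal_matrix U"
  shows "trace (spectral U f) = (\<Sum>i\<in>UNIV. f i)"
proof -
  have "trace (spectral U f) = trace (U ** (transpose U ** diag_matrix (\<chi> i. f i)))"
    unfolding spectral_def by (rule trace_mul_sym)
  also have "\<dots> = trace (diag_matrix (\<chi> i. f i))"
    using assms by (simp add: matrix_mul_assoc orthogonal_matrix_def)
  finally show ?thesis
    by (simp add: trace_def diag_matrix_def)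
qed

lemma inner_spectral:
  "x \<bullet> (spectral U f *v x) = (\<Sum>i\<in>UNIV. f i * ((U *v x) $ i)\<^sup>2)"
proof -
  have "x \<bullet> (spectral U f *v x) = x \<bullet> (transpose U *v (\<chi> i. f i * (U *v x) $ i))"
    by (simp only: spectral_def diag_matrix_apply[symmetric] matrix_vector_mul_assoc
      matrix_mul_assoc)
  also have "\<dots> = (U *v x) \<bullet> (\<chi> i. f i * (U *v x) $ i)"
    by (simp only: dot_lmul_matrix[symmetric] vector_transpose_matrix)
  finally show ?thesis
    by (simp add: inner_vec_def power2_eq_square mult_ac)
qed

lemma pos_def_spectral_pos:
  assumes U: "orthogonal_matrix U" and pd: "pos_def_matrix (spectral U f)"
  shows "0 < f i"
proof -
  obtain x where Ux: "U *v x = axis i 1"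
    using orthogonal_matrix_vector_surj[OF U] .
  then have "x \<noteq> 0"
    by (auto simp: axis_eq_0_iff)
  then have "0 < x \<bullet> (spectral U f *v x)"
    using pd by (simp add: pos_def_matrix_def)
  also have "\<dots> = f i"
    by (simp add: inner_spectral Ux axis_def if_distrib[of "\<lambda>x. x\<^sup>2"]
      if_distrib[of "\<lambda>x. _ * x"] cong: if_cong)
  finally show ?thesis .
qed

lemma eigenvalues_spectral:
  assumes U: "orthogonal_matrix U"
  shows "eigenvalues (spectral U f) = range f"
proof (intro set_eqI iffI)
  note inj = orthogonal_matrix_vector_eq_iff[OF U]
  fix \<mu>
  {
    assume "\<mu> \<in> eigenvalues (spectral U f)"
    then obtain x where x: "x \<noteq> 0" "spectral U f *v x = \<mu> *\<^sub>R x"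
      by (auto simp: eigenvalues_def)
    have "U *v x \<noteq> 0"
      using inj[of x 0] x by auto
    then obtain i where i: "(U *v x) $ i \<noteq> 0"
      by (auto simp: vec_eq_iff)
    have "f i * (U *v x) $ i = (U *v (\<mu> *\<^sub>R x)) $ i"
      using spectral_apply[OF U, of f x] x by simp
    then show "\<mu> \<in> range f"
      using i by (auto simp: matrix_vector_mult_scaleR)
  next
    assume "\<mu> \<in> range f"
    then obtain i where i: "\<mu> = f i" by auto
    obtain x where Ux: "U *v x = axis i 1"
      using orthogonal_matrix_vector_surj[OF U] .
    then have "x \<noteq> 0"
      by (auto simp: axis_eq_0_iff)
    moreover have "spectral U f *v x = \<mu> *\<^sub>R x"
      by (subst inj[symmetric])
        (simp add: spectral_apply[OF U] Ux i matrix_vector_mult_scaleR vec_eq_iff axis_def)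
    ultimately show "\<mu> \<in> eigenvalues (spectral U f)"
      by (auto simp: eigenvalues_def)
  }
qed

section \<open>The effective regularization\<close>

text \<open>
  Existence is the intermediate value theorem: at \<open>0\<close> the right-hand side is the larger one, and it
  never exceeds \<open>l + (\<Sum>i. s i) / n\<close>. For uniqueness, divide the equation by \<open>k\<close>: it becomes
  \<open>1 = l / k + (\<Sum>i. s i / (s i + k)) / n\<close>, whose right-hand side is strictly decreasing.
\<close>

lemma ex1_fixed_point:
  fixes s :: "'n::finite \<Rightarrow> real"
  assumes n: "0 < n" and s: "\<And>i. 0 < s i" and l: "0 < l"
  shows "\<exists>!k. 0 < k \<and> k = l + k / real n * (\<Sum>i\<in>UNIV. s i / (s i + k))"
proof (rule ex_ex1I)
  define h where "h k = k - (l + k / real n * (\<Sum>i\<in>UNIV. s i / (s i + k)))" for k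
  define M where "M = l + (\<Sum>i\<in>UNIV. s i) / real n"
  have M: "0 < M"
    using s l unfolding M_def
    by (intro add_pos_nonneg sum_nonneg divide_nonneg_nonneg) (auto intro: less_imp_le)
  have "M * (\<Sum>i\<in>UNIV. s i / (s i + M)) \<le> (\<Sum>i\<in>UNIV. s i)"
    unfolding sum_distrib_left
  proof (rule sum_mono)
    show "M * (s i / (s i + M)) \<le> s i" for i
      using s[of i] M by (simp add: field_simps)
  qed
  moreover have "h M = ((\<Sum>i\<in>UNIV. s i) - M * (\<Sum>i\<in>UNIV. s i / (s i + M))) / real n"
  proof -
    have "M - l = (\<Sum>i\<in>UNIV. s i) / real n"
      by (simp add: M_def)
    then show ?thesis
      unfolding h_def diff_divide_distrib by simp
  qed
  ultimately have "0 \<le> h M"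
    by simp
  moreover have "h 0 \<le> 0"
    using l by (simp add: h_def)
  moreover have "continuous_on {0..M} h"
    unfolding h_def
  proof (intro continuous_intros ballI)
    show "real n \<noteq> 0" using n by simp
    show "s i + k \<noteq> 0" if "k \<in> {0..M}" for i k
      using s[of i] that by (simp add: add_pos_nonneg less_imp_neq[symmetric])
  qed
  ultimately obtain k where k: "0 \<le> k" "k \<le> M" "h k = 0"
    using IVT'[of h 0 0 M] M by auto
  moreover have "k \<noteq> 0"
    using k l by (auto simp: h_def)
  ultimately show "\<exists>k. 0 < k \<and> k = l + k / real n * (\<Sum>i\<in>UNIV. s i / (s i + k))"
    by (intro exI[of _ k]) (auto simp: h_def)
next
  define g where "g k = l / k + (\<Sum>i\<in>UNIV. s i / (s i + k)) / real n" for k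
  have g_less: "g y < g x" if "0 < x" "x < y" for x y
    unfolding g_def
  proof (rule add_less_le_mono)
    show "l / y < l / x"
      using that l by (simp add: divide_strict_left_mono)
    show "(\<Sum>i\<in>UNIV. s i / (s i + y)) / real n \<le> (\<Sum>i\<in>UNIV. s i / (s i + x)) / real n"
      using that s n
      by (intro divide_right_mono sum_mono divide_left_mono mult_pos_pos add_pos_pos) 
        (auto intro: less_imp_le less_trans)
  qed
  have g_one: "g k = 1" if "0 < k" "k = l + k / real n * (\<Sum>i\<in>UNIV. s i / (s i + k))" for k
  proof -
    have "k * g k = k"
      using that by (simp add: g_def distrib_left)
    then show ?thesis using that by simp
  qed
  fix x y
  assume "0 < x \<and> x = l + x / real n * (\<Sum>i\<in>UNIV. s i / (s i + x))"
    and "0 < y \<and> y = l + y / real n * (\<Sum>i\<in>UNIV. s i / (s i + y))"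
  then have "0 < x" "0 < y" "g x = 1" "g y = 1"
    by (simp_all only: g_one)
  then show "x = y"
    using g_less[of x y] g_less[of y x] by (cases x y rule: linorder_cases) simp_all
qed

lemma kappa_spectral:
  fixes U :: "real ^ 'n ^ 'n"
  assumes U: "orthogonal_matrix U" and n: "0 < n" and s: "\<And>i. 0 < s i" and l: "0 < l"
  defines "k \<equiv> kappa n (spectral U s) l"
  shows "0 < k" and "k = l + k / real n * (\<Sum>i\<in>UNIV. s i / (s i + k))"
proof -
  have trace: "gam TYPE('n) n * k * norm_trace (spectral U s ** matrix_inv (spectral U s + k *\<^sub>R mat 1))
      = k / real n * (\<Sum>i\<in>UNIV. s i / (s i + k))" if "0 < k" for k
  proof -
    have "s i + k \<noteq> 0" for i
      using s[of i] that by simp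
    then show ?thesis
      by (simp add: spectral_plus_scaleR_one[OF U] spectral_inverse[OF U] spectral_mult[OF U]
          norm_trace_def trace_spectral[OF U] gam_def divide_inverse)
  qed
  have "(0 < k \<and> k = l + gam TYPE('n) n * k *
        norm_trace (spectral U s ** matrix_inv (spectral U s + k *\<^sub>R mat 1))) \<longleftrightarrow>
      (0 < k \<and> k = l + k / real n * (\<Sum>i\<in>UNIV. s i / (s i + k)))" for k
    by (rule conj_cong[OF refl]) (simp only: trace)
  then have k: "k = (THE k. 0 < k \<and> k = l + k / real n * (\<Sum>i\<in>UNIV. s i / (s i + k)))"
    unfolding k_def kappa_def by (simp only:)
  have *: "0 < k \<and> k = l + k / real n * (\<Sum>i\<in>UNIV. s i / (s i + k))"
    unfolding k by (rule theI'[OF ex1_fixed_point[of n s l, OF n s l]])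
  show "0 < k"
    using * by (rule conjunct1)
  show "k = l + k / real n * (\<Sum>i\<in>UNIV. s i / (s i + k))"
    using * by (rule conjunct2)
qed

text \<open>The fixed-point equation determines the regularization from its effective value, which gives
  an explicit left inverse.\<close>

lemma inj_on_kappa_spectral:
  assumes "orthogonal_matrix U" and "0 < n" and "\<And>i. 0 < s i"
  shows "inj_on (kappa n (spectral U s)) {0<..}"
proof (rule inj_on_inverseI[where g = "\<lambda>k. k - k / real n * (\<Sum>i\<in>UNIV. s i / (s i + k))"])
  fix l :: real
  assume "l \<in> {0<..}"
  then have "0 < l" by simp
  let ?k = "kappa n (spectral U s) l"
  show "?k - ?k / real n * (\<Sum>i\<in>UNIV. s i / (s i + ?k)) = l"
    using kappa_spectral(2)[of U n s l, OF assms \<open>0 < l\<close>] by linarith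
qed

section \<open>The gap between risk and residual correlation\<close>

text \<open>
  The bias terms combine through \<open>\<kappa>\<^sub>t - (\<sigma>\<^sub>i + \<kappa>\<^sub>t) = - \<sigma>\<^sub>i\<close>. They then carry the same weights
  \<open>\<sigma>\<^sub>i\<^sup>2 / ((\<sigma>\<^sub>i + \<kappa>\<^sub>t)\<^sup>2 (\<sigma>~\<^sub>i + \<kappa>\<^sub>s))\<close> as the variance terms, so that everything is one sum.
\<close>

lemma risk_minus_corr_eq:
  fixes U :: "real ^ 'n ^ 'n" and st ss \<beta> :: "real ^ 'n"
  assumes U: "orthogonal_matrix U"
    and n: "0 < nt" "0 < ns" and st: "\<And>i. 0 < st $ i" and ss: "\<And>i. 0 < ss $ i"
    and l: "0 < lt" "0 < ls"
  defines "St \<equiv> spectral U (($) st)" and "Ss \<equiv> spectral U (($) ss)"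
  shows "teacher_risk nt St \<beta> s2 lt - residual_corr nt ns St Ss \<beta> s2 lt ls =
    kappa ns Ss ls * (\<Sum>i\<in>UNIV. c_coef nt St U st \<beta> s2 lt i / (ss $ i + kappa ns Ss ls))"
proof -
  define kt where "kt = kappa nt St lt"
  define ks where "ks = kappa ns Ss ls"
  define b where "b = b_coef nt St lt"
  define Q where "Q = q20 nt St \<beta> lt"
  define v where "v i = ((U *v \<beta>) $ i)\<^sup>2" for i
  define w where "w i = (st $ i)\<^sup>2 / (st $ i + kt)\<^sup>2 / (ss $ i + ks)" for i
  have kt: "0 < kt"
    unfolding kt_def St_def using U n st l by (intro kappa_spectral) auto
  have ks: "0 < ks"
    unfolding ks_def Ss_def using U n ss l by (intro kappa_spectral) auto
  have pos: "0 < st $ i + kt" "0 < ss $ i + ks" for i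
    using st[of i] ss[of i] kt ks by simp_all
  then have nz: "st $ i + kt \<noteq> 0" "ss $ i + ks \<noteq> 0" for i
    by (metis less_irrefl)+
  have Gt: "G_mat nt St lt = spectral U (\<lambda>i. inverse (st $ i + kt))"
    using nz by (simp add: G_mat_def kt_def[symmetric])
      (simp add: St_def spectral_plus_scaleR_one[OF U] spectral_inverse[OF U])
  have Gs: "G_mat ns Ss ls = spectral U (\<lambda>i. inverse (ss $ i + ks))"
    using nz by (simp add: G_mat_def ks_def[symmetric])
      (simp add: Ss_def spectral_plus_scaleR_one[OF U] spectral_inverse[OF U])
  note calc = spectral_mult[OF U] spectral_power[OF U]
  have q: "q_coef St \<beta> (G_mat nt St lt) (G_mat ns Ss ls) i j =
      (\<Sum>a\<in>UNIV. st $ a / ((st $ a + kt) ^ i * (ss $ a + ks) ^ j) * v a)" for i j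
    unfolding q_coef_def Gt Gs unfolding St_def
    by (simp add: calc inner_spectral v_def divide_inverse power_inverse mult_ac)
  have t: "t_coef nt St (G_mat nt St lt) (G_mat ns Ss ls) 2 1 = (\<Sum>a\<in>UNIV. w a) / real nt"
    unfolding t_coef_def Gt Gs unfolding St_def
    by (simp add: calc norm_trace_def trace_spectral[OF U] gam_def w_def divide_inverse
        power_inverse mult_ac)
  have q20: "q_coef St \<beta> (G_mat nt St lt) (G_mat ns Ss ls) 2 0 = Q"
    by (simp add: Q_def q20_def q_coef_def)
  have bias: "- kt * q_coef St \<beta> (G_mat nt St lt) (G_mat ns Ss ls) 1 1
      + kt\<^sup>2 * q_coef St \<beta> (G_mat nt St lt) (G_mat ns Ss ls) 2 1
      = - (\<Sum>a\<in>UNIV. kt * w a * v a)"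
  proof -
    have "- kt * (st $ a / ((st $ a + kt) * (ss $ a + ks)) * v a)
        + kt\<^sup>2 * (st $ a / ((st $ a + kt)\<^sup>2 * (ss $ a + ks)) * v a) = - (kt * w a * v a)" for a
    proof -
      have "- kt * (y / (z * r) * v) + kt\<^sup>2 * (y / (z\<^sup>2 * r) * v) = kt * y * v * (kt - z) / (z\<^sup>2 * r)"
        if "z \<noteq> 0" "r \<noteq> 0" for y z r v
        using that by (simp add: divide_simps) (simp add: power2_eq_square algebra_simps)
      from this[OF nz(1) nz(2), of "st $ a" a a "v a"] show ?thesis
        by (simp add: w_def power2_eq_square)
    qed
    then show ?thesis
      unfolding q by (simp add: sum_distrib_left sum_negf[symmetric] sum.distrib[symmetric])
  qed
  have "teacher_risk nt St \<beta> s2 lt - residual_corr nt ns St Ss \<beta> s2 lt ls =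
      ks * (- (\<Sum>a\<in>UNIV. kt * w a * v a) + (kt\<^sup>2 * b * Q + s2 * b) / real nt * (\<Sum>a\<in>UNIV. w a))"
    unfolding residual_corr_def Let_def kt_def[symmetric] ks_def[symmetric] b_def[symmetric]
      q20 t bias[symmetric] by (simp add: algebra_simps add_divide_distrib)
  also have "\<dots> = ks * (\<Sum>i\<in>UNIV. c_coef nt St U st \<beta> s2 lt i / (ss $ i + ks))"
  proof -
    have "c_coef nt St U st \<beta> s2 lt i / (ss $ i + ks) =
        - (kt * w i * v i) + (kt\<^sup>2 * b * Q + s2 * b) / real nt * w i" for i
    proof -
      have "c_coef nt St U st \<beta> s2 lt i / (ss $ i + ks) =
        kt * w i * ((kt\<^sup>2 * b * Q + s2 * b) / (kt * real nt) - v i)"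
        by (simp add: c_coef_def Let_def kt_def b_def Q_def v_def w_def ks_def)
      also have "\<dots> = - (kt * w i * v i) + (kt\<^sup>2 * b * Q + s2 * b) / real nt * w i"
        using kt n by (simp add: field_simps)
      finally show ?thesis .
    qed
    then show ?thesis
      by (simp only: sum.distrib sum_negf sum_distrib_left)
  qed
  finally show ?thesis
    by (simp add: ks_def)
qed

section \<open>Counting the zeros of the gap\<close>

theorem mainTheorem4:
  fixes St Ss U :: "real ^ 'n ^ 'n" and st ss \<beta> :: "real ^ 'n"
    and s2 lt :: real and nt ns :: nat
  assumes "0 < nt" and "0 < ns"
    and "pos_def_matrix St" and "pos_def_matrix Ss"
    and "orthogonal_matrix U"
    and "St = transpose U ** diag_matrix st ** U"
    and "Ss = transpose U ** diag_matrix ss ** U"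
    and "0 \<le> s2"
    and "0 < lt" and "lt \<notin> Lambda_t nt ns St Ss \<beta> s2"
  shows "finite (Lambda_s nt ns St Ss \<beta> s2 lt) \<and>
         card (Lambda_s nt ns St Ss \<beta> s2 lt)
           \<le> sign_changes (filter (\<lambda>x. x \<noteq> 0) (d_seq nt St Ss U st ss \<beta> s2 lt))"
proof -
  let ?d = "\<lambda>\<mu>. \<Sum>k | ss $ k = \<mu>. c_coef nt St U st \<beta> s2 lt k"
  have U: "orthogonal_matrix U" by fact
  have St: "St = spectral U (($) st)" and Ss: "Ss = spectral U (($) ss)"
    using assms by (simp_all add: spectral_def)
  have st: "0 < st $ i" and ss: "0 < ss $ i" for i
    using pos_def_spectral_pos[OF U, of "($) st" i] pos_def_spectral_pos[OF U, of "($) ss" i]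
      assms(3,4) St Ss by auto
  define f where "f x = (\<Sum>\<mu>\<in>range (($) ss). ?d \<mu> / (\<mu> + x))" for x
  have gap: "teacher_risk nt St \<beta> s2 lt - residual_corr nt ns St Ss \<beta> s2 lt ls =
      kappa ns Ss ls * f (kappa ns Ss ls)" if "0 < ls" for ls
  proof -
    have "(\<Sum>i\<in>UNIV. c_coef nt St U st \<beta> s2 lt i / (ss $ i + x)) =
        (\<Sum>\<mu>\<in>range (($) ss). \<Sum>i | ss $ i = \<mu>. c_coef nt St U st \<beta> s2 lt i / (ss $ i + x))" for x
      using sum.image_gen[of UNIV "\<lambda>i. c_coef nt St U st \<beta> s2 lt i / (ss $ i + x)" "($) ss"] by simp
    then show ?thesis
      using risk_minus_corr_eq[OF U assms(1,2) st ss assms(9) that, of \<beta> s2]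
      by (simp add: f_def St Ss sum_divide_distrib)
  qed
  have kappa_pos: "0 < kappa ns Ss ls" if "0 < ls" for ls
    unfolding Ss using kappa_spectral(1)[OF U assms(2), of "($) ss" ls] ss that by simp

  define ps where "ps = filter (\<lambda>\<mu>. ?d \<mu> \<noteq> 0) (sorted_list_of_set (range (($) ss)))"
  define m where "m = length ps"
  have ps: "sorted ps" "distinct ps" "set ps = {\<mu> \<in> range (($) ss). ?d \<mu> \<noteq> 0}"
    by (auto simp: ps_def sorted_wrt_filter)
  \<comment> \<open>Only the eigenvalues in \<open>ps\<close> contribute; the exponent \<open>Suc 0\<close> matches the Descartes rule.\<close>
  have f_eq: "f x = (\<Sum>i<m. ?d (ps ! i) / (ps ! i + x) ^ Suc 0)" for x
  proof -
    have "f x = (\<Sum>\<mu>\<in>set ps. ?d \<mu> / (\<mu> + x))"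
      unfolding f_def ps(3) by (intro sum.mono_neutral_right) auto
    also have "\<dots> = (\<Sum>\<mu>\<leftarrow>ps. ?d \<mu> / (\<mu> + x))"
      using ps(2) by (simp add: sum_list_distinct_conv_sum_set)
    finally show ?thesis
      by (simp add: sum_list_sum_nth m_def lessThan_atLeast0)
  qed
  have "m \<noteq> 0"
  proof
    assume "m = 0"
    then have "lt \<in> Lambda_t nt ns St Ss \<beta> s2"
      using gap f_eq assms(9) by (simp add: Lambda_t_def)
    then show False using assms(10) by simp
  qed
  then have zeros: "finite {x. 0 < x \<and> f x = 0}"
      "card {x. 0 < x \<and> f x = 0} \<le> card {i. Suc i < m \<and> ?d (ps ! i) * ?d (ps ! Suc i) < 0}"
  proof -
    have mem: "ps ! i \<in> {\<mu> \<in> range (($) ss). ?d \<mu> \<noteq> 0}" if "i < m" for i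
      using that ps(3) nth_mem[of i ps] unfolding m_def by metis
    have *: "0 < ps ! i" "?d (ps ! i) \<noteq> 0" if "i < m" for i
      using mem[OF that] ss by auto
    have **: "ps ! i < ps ! j" if "i < j" "j < m" for i j
      using that ps(1,2) unfolding m_def
      by (metis strict_sorted_iff sorted_wrt_nth_less)
    from card_zeros_partial_fractions_le[of m "\<lambda>i. ps ! i" "\<lambda>i. ?d (ps ! i)" 0] * ** \<open>m \<noteq> 0\<close>
    show "finite {x. 0 < x \<and> f x = 0}"
      "card {x. 0 < x \<and> f x = 0} \<le> card {i. Suc i < m \<and> ?d (ps ! i) * ?d (ps ! Suc i) < 0}"
      unfolding f_eq by blast+
  qed
  have "filter (\<lambda>x. x \<noteq> 0) (d_seq nt St Ss U st ss \<beta> s2 lt) = map ?d ps"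
    by (simp add: d_seq_def ps_def Ss eigenvalues_spectral[OF U] filter_map comp_def)
  then have changes: "sign_changes (filter (\<lambda>x. x \<noteq> 0) (d_seq nt St Ss U st ss \<beta> s2 lt)) =
      card {i. Suc i < m \<and> ?d (ps ! i) * ?d (ps ! Suc i) < 0}"
    by (auto simp: sign_changes_def m_def intro!: arg_cong[where f = card])
  have inj: "inj_on (kappa ns Ss) (Lambda_s nt ns St Ss \<beta> s2 lt)"
    unfolding Ss
    by (rule inj_on_subset[OF inj_on_kappa_spectral[OF U assms(2) ss]]) (auto simp: Lambda_s_def)
  have sub: "kappa ns Ss ` Lambda_s nt ns St Ss \<beta> s2 lt \<subseteq> {x. 0 < x \<and> f x = 0}"
    using gap kappa_pos by (fastforce simp: Lambda_s_def)
  show ?thesis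
    using inj_on_finite[OF inj sub zeros(1)] card_inj_on_le[OF inj sub zeros(1)] zeros(2)
    unfolding changes by linarith
qed

end
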